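(* Let $p_1,p_2,r_1,r_2$ be positive rational numbers such that $r_2>r_1$ and $p_2>p_1(r_1+r_2)/(r_2-r_1)$. Then there is a rational convex quadrilateral $OABC$ with two equal sides whose sides $OA=a$, $AB=b$, $BC=c$, $OC=d$, diagonals $OB=e$, $AC=f$ and area $K$ are \begin{align*} a&=b=(p_1^2+p_2^2)(r_1^2+r_2^2),\\ c&=4(p_1^2+p_2^2)r_1r_2,\\ d&=2(p_1r_1+p_1r_2+p_2r_1-p_2r_2)(p_1r_1-p_1r_2-p_2r_1-p_2r_2),\\ e&=2(r_1^2+r_2^2)(p_2^2-p_1^2),\\ f&=(p_1^2+p_2^2)(r_1^2+r_2^2),\\ K&=2(p_2^2-p_1^2)(2p_1r_1r_2+p_2r_1^2-p_2r_2^2)(p_1r_1^2-p_1r_2^2-2p_2r_1r_2). \end{align*}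
   Context: A quadrilateral is called rational if the lengths of its four sides, the lengths of its two diagonals and its area are all rational numbers. $OABC$ denotes a quadrilateral with vertices in this cyclic order. *)

theory Defs
  imports "HOL-Analysis.Analysis"
begin

text \<open>Quadrilaterals in the Euclidean plane, given by their vertices in cyclic order.\<close>

definition quad_path :: "real^2 \<Rightarrow> real^2 \<Rightarrow> real^2 \<Rightarrow> real^2 \<Rightarrow> real \<Rightarrow> real^2" where
  "quad_path P Q R S = linepath P Q +++ linepath Q R +++ linepath R S +++ linepath S P"

text \<open>Straight angles are excluded: with collinear consecutive vertices the simple closed curve
  would bound a triangle.\<close>

definition quadrilateral :: "real^2 \<Rightarrow> real^2 \<Rightarrow> real^2 \<Rightarrow> real^2 \<Rightarrow> bool" where
  "quadrilateral P Q R S \<longleftrightarrow>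
     simple_path (quad_path P Q R S) \<and>
     \<not> collinear {P, Q, R} \<and> \<not> collinear {Q, R, S} \<and>
     \<not> collinear {R, S, P} \<and> \<not> collinear {S, P, Q}"

definition quad_region :: "real^2 \<Rightarrow> real^2 \<Rightarrow> real^2 \<Rightarrow> real^2 \<Rightarrow> (real^2) set" where
  "quad_region P Q R S =
     path_image (quad_path P Q R S) \<union> inside (path_image (quad_path P Q R S))"

definition convex_quadrilateral :: "real^2 \<Rightarrow> real^2 \<Rightarrow> real^2 \<Rightarrow> real^2 \<Rightarrow> bool" where
  "convex_quadrilateral P Q R S \<longleftrightarrow> quadrilateral P Q R S \<and> convex (quad_region P Q R S)"

definition quad_area :: "real^2 \<Rightarrow> real^2 \<Rightarrow> real^2 \<Rightarrow> real^2 \<Rightarrow> real" where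
  "quad_area P Q R S = measure lebesgue (quad_region P Q R S)"

definition rational_quadrilateral :: "real^2 \<Rightarrow> real^2 \<Rightarrow> real^2 \<Rightarrow> real^2 \<Rightarrow> bool" where
  "rational_quadrilateral P Q R S \<longleftrightarrow>
     quadrilateral P Q R S \<and>
     dist P Q \<in> \<rat> \<and> dist Q R \<in> \<rat> \<and> dist R S \<in> \<rat> \<and> dist S P \<in> \<rat> \<and>
     dist P R \<in> \<rat> \<and> dist Q S \<in> \<rat> \<and>
     quad_area P Q R S \<in> \<rat>"

end

theory Submission
  imports Defs
begin

text \<open>
  Since the prescribed lengths satisfy \<open>OA = AB = AC\<close>, the vertices \<open>O\<close>, \<open>C\<close>, \<open>B\<close> must lie on
  a circle about \<open>A\<close> of radius \<open>R = (p\<^sub>1^2 + p\<^sub>2^2) * (r\<^sub>1^2 + r\<^sub>2^2)\<close>, and \<open>OB\<close>, \<open>BC\<close>, \<open>OC\<close> are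
  chords of it. Put \<open>A\<close> at the origin, \<open>B\<close> at polar angle \<open>0\<close>, \<open>C\<close> at \<open>2 * \<beta>\<close> and \<open>O\<close> at
  \<open>2 * \<alpha>\<close>. The chords are then \<open>2 * R * sin \<alpha>\<close>, \<open>2 * R * sin \<beta>\<close> and \<open>2 * R * sin (\<alpha> - \<beta>)\<close>, so
  that the lengths demand
  \<open>sin \<alpha> = (p\<^sub>2^2 - p\<^sub>1^2) / (p\<^sub>1^2 + p\<^sub>2^2)\<close> and \<open>sin \<beta> = 2 * r\<^sub>1 * r\<^sub>2 / (r\<^sub>1^2 + r\<^sub>2^2)\<close>.
  Both are sines of rational points of the unit circle, whence all quantities are rational. The
  hypothesis on \<open>p\<^sub>2\<close> says exactly that \<open>sin (\<alpha> - \<beta>) > 0\<close>. Therefore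
  \<open>0 < \<beta> < \<alpha> < \<pi> / 2\<close>: the point \<open>C\<close> lies on the arc between \<open>B\<close> and \<open>O\<close>, the angle at \<open>A\<close>
  is less than \<open>\<pi>\<close>, and the path turns left at each vertex
  (\<open>circular_quadrilateral\<close>).

  Convexity and area are read off from the four left turns alone. The closed half-planes to the
  left of the sides meet in a compact convex set whose frontier is the quadrilateral
  (\<open>path_image_eq_frontier\<close>). The inside of the frontier of a bounded convex set is the interior
  of that set, so this intersection is the enclosed region (\<open>quad_region_eq\<close>). A diagonal cuts it
  into two triangles that overlap in a null set (\<open>quad_area_left_turning\<close>).
\<close>

section \<open>Orientation of a point triple\<close>

text \<open>Twice the signed area of the triangle, positive for a left turn. As a function of the third
  point alone it is affine, which makes its sign cut the plane into half-planes.\<close>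

definition turn :: "real^2 \<Rightarrow> real^2 \<Rightarrow> real^2 \<Rightarrow> real" where
  "turn P Q X = (Q$1 - P$1) * (X$2 - P$2) - (Q$2 - P$2) * (X$1 - P$1)"

lemma turn_rotate: "turn Q X P = turn P Q X"
  by (simp add: turn_def algebra_simps)

lemma turn_degenerate [simp]: "turn P Q P = 0" "turn P Q Q = 0"
  by (simp_all add: turn_def)

text \<open>Both sides are twice the signed area of \<open>P Q R S\<close>, cut along one diagonal or the other.\<close>

lemma turn_four_points: "turn P Q R + turn R S P = turn Q R S + turn S P Q"
  by (simp add: turn_def algebra_simps)

lemma turn_affine:
  assumes "u + v = 1"
  shows "turn P Q (u *\<^sub>R X + v *\<^sub>R Y) = u * turn P Q X + v * turn P Q Y"
proof -
  have "v = 1 - u" using assms by simp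
  show ?thesis unfolding \<open>v = 1 - u\<close> by (simp add: turn_def algebra_simps)
qed

lemma turn_nonzero_imp_not_collinear:
  assumes "turn P Q R \<noteq> 0"
  shows "\<not> collinear {P, Q, R}"
proof
  assume "collinear {P, Q, R}"
  then obtain u where u: "\<forall>x\<in>{P, Q, R}. \<forall>y\<in>{P, Q, R}. \<exists>c. x - y = c *\<^sub>R u"
    unfolding collinear_def by blast
  obtain c d where "Q - P = c *\<^sub>R u" "R - P = d *\<^sub>R u"
    using u by blast
  then have "Q$i - P$i = c * u$i" "R$i - P$i = d * u$i" for i
    by (metis vector_minus_component vector_scaleR_component real_scaleR_def)+
  then have "turn P Q R = 0"
    by (simp add: turn_def)
  then show False using assms by simp
qed

lemma turn_eq_inner:
  obtains a b where "\<And>X. turn P Q X = a \<bullet> X - b" and "P \<noteq> Q \<Longrightarrow> a \<noteq> 0"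
proof
  define a :: "real^2" where "a = vector [P$2 - Q$2, Q$1 - P$1]"
  show "turn P Q X = a \<bullet> X - a \<bullet> P" for X
    by (simp add: turn_def a_def inner_vec_def sum_2 vector_2 algebra_simps)
  show "a \<noteq> 0" if "P \<noteq> Q"
  proof
    assume "a = 0"
    then have "a$1 = 0" "a$2 = 0" by simp_all
    then show False using that by (simp add: a_def vec_eq_iff forall_2 vector_2)
  qed
qed

lemma convex_left_halfplane: "convex {X. turn P Q X \<ge> 0}"
proof -
  obtain a b where "\<And>X. turn P Q X = a \<bullet> X - b"
    using turn_eq_inner by metis
  then show ?thesis using convex_halfspace_ge[of b a] by simp
qed

lemma interior_left_halfplane:
  assumes "P \<noteq> Q"
  shows "interior {X. turn P Q X \<ge> 0} = {X. turn P Q X > 0}"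
proof -
  obtain a b where "\<And>X. turn P Q X = a \<bullet> X - b" "a \<noteq> 0"
    using turn_eq_inner assms by metis
  then show ?thesis using interior_halfspace_ge[of a b] by simp
qed

lemma negligible_turn_line:
  assumes "P \<noteq> Q"
  shows "negligible {X. turn P Q X = 0}"
proof -
  obtain a b where "\<And>X. turn P Q X = a \<bullet> X - b" "a \<noteq> 0"
    using turn_eq_inner assms by metis
  then show ?thesis using negligible_hyperplane[of a b] by simp
qed

text \<open>The three turns at \<open>X\<close>, divided by their constant sum \<open>turn P Q R\<close>, are the barycentric
  coordinates of \<open>X\<close>.\<close>

lemma triangle_eq_halfplanes:
  assumes pos: "turn P Q R > 0"
  shows "convex hull {P, Q, R} = {X. turn P Q X \<ge> 0 \<and> turn Q R X \<ge> 0 \<and> turn R P X \<ge> 0}"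
    (is "_ = ?H")
proof
  have "?H = {X. turn P Q X \<ge> 0} \<inter> {X. turn Q R X \<ge> 0} \<inter> {X. turn R P X \<ge> 0}"
    by auto
  then have "convex ?H"
    by (simp add: convex_Int convex_left_halfplane)
  moreover have "{P, Q, R} \<subseteq> ?H"
  proof -
    have "turn Q R P > 0" "turn R P Q > 0"
      using pos by (metis turn_rotate)+
    then show ?thesis using pos by simp
  qed
  ultimately show "convex hull {P, Q, R} \<subseteq> ?H"
    by (simp add: hull_minimal)
next
  show "?H \<subseteq> convex hull {P, Q, R}"
  proof
    fix X assume X: "X \<in> ?H"
    define D u v w where "D = turn P Q R" and "u = turn Q R X / D"
      and "v = turn R P X / D" and "w = turn P Q X / D"
    have D: "D > 0" using pos by (simp add: D_def)
    have sum: "turn Q R X + turn R P X + turn P Q X = D"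
      by (simp add: D_def turn_def algebra_simps)
    have "0 \<le> u" "0 \<le> v" "0 \<le> w"
      using X D by (simp_all add: u_def v_def w_def)
    moreover have "u + v + w = 1"
      using sum D by (simp add: u_def v_def w_def add_divide_distrib[symmetric])
    moreover have "X = u *\<^sub>R P + v *\<^sub>R Q + w *\<^sub>R R"
    proof -
      have "D * X$i = turn Q R X * P$i + turn R P X * Q$i + turn P Q X * R$i" for i
        using exhaust_2[of i] by (auto simp: D_def turn_def algebra_simps)
      then have "X$i = (turn Q R X * P$i + turn R P X * Q$i + turn P Q X * R$i) / D" for i
        using D by (metis nonzero_mult_div_cancel_left less_irrefl)
      then show ?thesis
        by (simp add: vec_eq_iff u_def v_def w_def add_divide_distrib)
    qed
    ultimately show "X \<in> convex hull {P, Q, R}"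
      unfolding convex_hull_3 by blast
  qed
qed

lemma measure_triangle:
  assumes "turn P Q R > 0"
  shows "measure lebesgue (convex hull {P, Q, R}) = turn P Q R / 2"
proof -
  have "compact (convex hull {P, Q, R})"
    by (intro compact_convex_hull) simp
  then have "convex hull {P, Q, R} \<in> sets borel"
    by (simp add: borel_compact)
  then have "measure lebesgue (convex hull {P, Q, R}) = measure lborel (convex hull {P, Q, R})"
    by (simp add: measure_completion)
  also have "\<dots> = \<bar>- turn P Q R\<bar> / 2"
    unfolding content_triangle by (simp add: turn_def algebra_simps)
  finally show ?thesis using assms by simp
qed

section \<open>Quadrilaterals that turn left at every vertex\<close>

definition left_turning :: "real^2 \<Rightarrow> real^2 \<Rightarrow> real^2 \<Rightarrow> real^2 \<Rightarrow> bool" where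
  "left_turning P Q R S \<longleftrightarrow>
     turn P Q R > 0 \<and> turn Q R S > 0 \<and> turn R S P > 0 \<and> turn S P Q > 0"

definition left_of_sides :: "real^2 \<Rightarrow> real^2 \<Rightarrow> real^2 \<Rightarrow> real^2 \<Rightarrow> (real^2) set" where
  "left_of_sides P Q R S =
     {X. turn P Q X \<ge> 0 \<and> turn Q R X \<ge> 0 \<and> turn R S X \<ge> 0 \<and> turn S P X \<ge> 0}"

lemma left_turning_rotate: "left_turning P Q R S \<Longrightarrow> left_turning Q R S P"
  by (simp add: left_turning_def)

lemma left_of_sides_rotate: "left_of_sides Q R S P = left_of_sides P Q R S"
  by (auto simp: left_of_sides_def)

lemma left_of_sides_eq_Int:
  "left_of_sides P Q R S = {X. turn P Q X \<ge> 0} \<inter> {X. turn Q R X \<ge> 0} \<inter>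
     {X. turn R S X \<ge> 0} \<inter> {X. turn S P X \<ge> 0}"
  by (auto simp: left_of_sides_def)

lemma convex_left_of_sides: "convex (left_of_sides P Q R S)"
  unfolding left_of_sides_eq_Int by (intro convex_Int convex_left_halfplane)

lemma left_turning_distinct:
  assumes "left_turning P Q R S"
  shows "P \<noteq> Q" "Q \<noteq> R" "R \<noteq> S" "S \<noteq> P" "P \<noteq> R"
  using assms by (auto simp: left_turning_def turn_def)

lemma vertices_left_of_sides:
  assumes "left_turning P Q R S"
  shows "{P, Q, R, S} \<subseteq> left_of_sides P Q R S"
proof -
  have "turn Q R P > 0" "turn R S Q > 0" "turn S P R > 0" "turn P Q S > 0"
    using assms unfolding left_turning_def by (metis turn_rotate)+
  then show ?thesis
    using assms by (simp add: left_turning_def left_of_sides_def)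
qed

text \<open>On the line \<open>X = P + t (Q - P)\<close> the conditions for the two neighbouring sides become
  \<open>1 - t \<ge> 0\<close> and \<open>t \<ge> 0\<close>.\<close>

lemma left_of_sides_on_line:
  assumes lt: "left_turning P Q R S" and X: "X \<in> left_of_sides P Q R S" and 0: "turn P Q X = 0"
  shows "X \<in> closed_segment P Q"
proof -
  have "P \<noteq> Q" using left_turning_distinct[OF lt] by simp
  obtain t where t: "X = (1 - t) *\<^sub>R P + t *\<^sub>R Q"
  proof -
    \<comment> \<open>\<open>M / N\<close> is the parameter of the orthogonal projection of \<open>X\<close> onto the line.\<close>
    define N where "N = (Q$1 - P$1)^2 + (Q$2 - P$2)^2"
    have N: "N \<noteq> 0"
      using \<open>P \<noteq> Q\<close> by (auto simp: N_def vec_eq_iff forall_2 sum_power2_eq_zero_iff)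
    define M where "M = (X$1 - P$1) * (Q$1 - P$1) + (X$2 - P$2) * (Q$2 - P$2)"
    have "N * (X$1 - P$1) = M * (Q$1 - P$1)" "N * (X$2 - P$2) = M * (Q$2 - P$2)"
      using 0 unfolding N_def M_def turn_def by algebra+
    then have "X$1 - P$1 = M / N * (Q$1 - P$1)" "X$2 - P$2 = M / N * (Q$2 - P$2)"
      using N by (simp_all add: field_simps)
    then have "X = (1 - M / N) *\<^sub>R P + (M / N) *\<^sub>R Q"
      by (simp add: vec_eq_iff forall_2 algebra_simps)
    then show ?thesis by (rule that)
  qed
  have "turn Q R X = (1 - t) * turn P Q R" "turn S P X = t * turn S P Q"
    unfolding t by (simp_all add: turn_affine turn_rotate[of Q R P] turn_rotate[of P Q R])
  then have "0 \<le> 1 - t" "0 \<le> t"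
    using X lt by (auto simp: left_of_sides_def left_turning_def zero_le_mult_iff)
  then show ?thesis using t by (auto simp: in_segment)
qed

lemma path_image_quad_path:
  "path_image (quad_path P Q R S) =
     closed_segment P Q \<union> closed_segment Q R \<union> closed_segment R S \<union> closed_segment S P"
  by (simp add: quad_path_def path_image_join Un_assoc)

lemma closed_segment_left_of_sides:
  assumes lt: "left_turning P Q R S" and X: "X \<in> closed_segment P Q"
  shows "X \<in> left_of_sides P Q R S" "turn P Q X = 0"
proof -
  show "X \<in> left_of_sides P Q R S"
    using closed_segment_subset[of P "left_of_sides P Q R S" Q] vertices_left_of_sides[OF lt] X
      convex_left_of_sides by blast
  obtain t where "X = (1 - t) *\<^sub>R P + t *\<^sub>R Q"
    using X by (auto simp: in_segment)
  then show "turn P Q X = 0"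
    by (simp add: turn_affine)
qed

lemma side_eq:
  assumes "left_turning P Q R S"
  shows "closed_segment P Q = {X \<in> left_of_sides P Q R S. turn P Q X = 0}"
  using assms left_of_sides_on_line closed_segment_left_of_sides by blast

text \<open>The diagonal splits the region according to the sign of \<open>turn P R X\<close>. This also supplies
  the boundedness that an intersection of half-planes does not give by itself.\<close>

lemma left_of_sides_eq_triangles:
  assumes lt: "left_turning P Q R S"
  shows "left_of_sides P Q R S = convex hull {P, Q, R} \<union> convex hull {R, S, P}"
proof
  show "convex hull {P, Q, R} \<union> convex hull {R, S, P} \<subseteq> left_of_sides P Q R S"
    using vertices_left_of_sides[OF lt] by (simp add: hull_minimal convex_left_of_sides)
  have "turn R P X = - turn P R X" for X
    by (simp add: turn_def algebra_simps)
  then show "left_of_sides P Q R S \<subseteq> convex hull {P, Q, R} \<union> convex hull {R, S, P}"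
    using lt by (auto simp: left_of_sides_def left_turning_def triangle_eq_halfplanes)
qed

lemma compact_left_of_sides:
  assumes "left_turning P Q R S"
  shows "compact (left_of_sides P Q R S)"
  unfolding left_of_sides_eq_triangles[OF assms]
  by (intro compact_Un compact_convex_hull) simp_all

text \<open>A point of the intersection is interior unless it lies on one of the bounding lines, and the
  part of such a line inside the intersection is just a side.\<close>

lemma path_image_eq_frontier:
  assumes lt: "left_turning P Q R S"
  shows "path_image (quad_path P Q R S) = frontier (left_of_sides P Q R S)"
proof -
  let ?H = "left_of_sides P Q R S"
  note rot = left_turning_rotate
  have int: "interior ?H = {X. turn P Q X > 0 \<and> turn Q R X > 0 \<and> turn R S X > 0 \<and> turn S P X > 0}"
    unfolding left_of_sides_eq_Int using left_turning_distinct[OF lt]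
    by (auto simp: interior_left_halfplane)
  have sides: "closed_segment P Q = {X \<in> ?H. turn P Q X = 0}"
    "closed_segment Q R = {X \<in> ?H. turn Q R X = 0}"
    "closed_segment R S = {X \<in> ?H. turn R S X = 0}"
    "closed_segment S P = {X \<in> ?H. turn S P X = 0}"
    using side_eq[OF lt] side_eq[OF rot[OF lt]] side_eq[OF rot[OF rot[OF lt]]]
      side_eq[OF rot[OF rot[OF rot[OF lt]]]]
      left_of_sides_rotate by metis+
  have "closed ?H"
    by (rule compact_imp_closed[OF compact_left_of_sides[OF lt]])
  then have front: "frontier ?H = ?H - interior ?H"
    by (simp add: frontier_def)
  show ?thesis
  proof (rule set_eqI)
    fix X
    show "X \<in> path_image (quad_path P Q R S) \<longleftrightarrow> X \<in> frontier ?H"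
      unfolding path_image_quad_path sides front int
      unfolding left_of_sides_def Un_iff Diff_iff mem_Collect_eq
      by argo
  qed
qed

lemma quad_region_eq:
  assumes lt: "left_turning P Q R S"
  shows "quad_region P Q R S = left_of_sides P Q R S"
proof -
  let ?H = "left_of_sides P Q R S"
  have "compact ?H" by (rule compact_left_of_sides[OF lt])
  then have "closed ?H" "bounded ?H"
    by (simp_all add: compact_imp_closed compact_imp_bounded)
  then show ?thesis
    unfolding quad_region_def path_image_eq_frontier[OF lt]
    using inside_frontier_eq_interior[OF _ convex_left_of_sides, of P Q R S] interior_subset[of ?H]
    by (auto simp: frontier_def)
qed

lemma adjacent_sides_Int:
  assumes lt: "left_turning P Q R S"
  shows "closed_segment P Q \<inter> closed_segment Q R \<subseteq> {Q}"
proof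
  fix X assume X: "X \<in> closed_segment P Q \<inter> closed_segment Q R"
  obtain t where t: "X = (1 - t) *\<^sub>R Q + t *\<^sub>R R"
    using X by (auto simp: in_segment)
  have "turn P Q X = t * turn P Q R"
    unfolding t by (simp add: turn_affine)
  moreover have "turn P Q X = 0"
    using X closed_segment_left_of_sides(2)[OF lt] by blast
  ultimately have "t = 0"
    using lt by (simp add: left_turning_def)
  then show "X \<in> {Q}" using t by simp
qed

lemma opposite_sides_Int:
  assumes lt: "left_turning P Q R S"
  shows "closed_segment P Q \<inter> closed_segment R S = {}"
proof -
  have "turn P Q X > 0" if X: "X \<in> closed_segment R S" for X
  proof -
    obtain t where t: "X = (1 - t) *\<^sub>R R + t *\<^sub>R S" "0 \<le> t" "t \<le> 1"
      using X by (auto simp: in_segment)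
    have pos: "turn P Q R > 0" "turn P Q S > 0"
      using lt turn_rotate[of P Q S] by (simp_all add: left_turning_def)
    have "turn P Q X = (1 - t) * turn P Q R + t * turn P Q S"
      unfolding t by (simp add: turn_affine)
    moreover have "(1 - t) * turn P Q R + t * turn P Q S > 0"
      using t pos by (cases "t = 0") (auto intro!: add_nonneg_pos)
    ultimately show ?thesis by simp
  qed
  then show ?thesis
    using closed_segment_left_of_sides(2)[OF lt] by fastforce
qed

lemma simple_path_quad_path:
  assumes lt: "left_turning P Q R S"
  shows "simple_path (quad_path P Q R S)"
proof -
  note lt2 = left_turning_rotate[OF lt]
  note lt3 = left_turning_rotate[OF lt2]
  note lt4 = left_turning_rotate[OF lt3]
  have "arc (linepath R S +++ linepath S P)"
    using left_turning_distinct[OF lt] adjacent_sides_Int[OF lt3] by (simp add: arc_join_eq)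
  moreover have "closed_segment Q R \<inter> (closed_segment R S \<union> closed_segment S P) \<subseteq> {R}"
    using adjacent_sides_Int[OF lt2] opposite_sides_Int[OF lt2] by blast
  ultimately have "arc (linepath Q R +++ linepath R S +++ linepath S P)"
    using left_turning_distinct[OF lt] by (simp add: arc_join_eq path_image_join)
  moreover have "closed_segment P Q \<inter> (closed_segment Q R \<union> (closed_segment R S \<union> closed_segment S P))
      \<subseteq> {P, Q}"
    using adjacent_sides_Int[OF lt] adjacent_sides_Int[OF lt4] opposite_sides_Int[OF lt] by blast
  ultimately show ?thesis
    unfolding quad_path_def using left_turning_distinct[OF lt]
    by (subst simple_path_join_loop_eq) (simp_all add: path_image_join)
qed

lemma convex_quadrilateral_left_turning:
  assumes lt: "left_turning P Q R S"
  shows "convex_quadrilateral P Q R S"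
proof -
  have "quadrilateral P Q R S"
    using lt simple_path_quad_path[OF lt]
    by (simp add: quadrilateral_def left_turning_def turn_nonzero_imp_not_collinear)
  then show ?thesis
    by (simp add: convex_quadrilateral_def quad_region_eq[OF lt] convex_left_of_sides)
qed

lemma quad_area_left_turning:
  assumes lt: "left_turning P Q R S"
  shows "quad_area P Q R S = (turn P Q R + turn R S P) / 2"
proof -
  let ?T = "convex hull {P, Q, R}" and ?U = "convex hull {R, S, P}"
  have pos: "turn P Q R > 0" "turn R S P > 0"
    using lt by (simp_all add: left_turning_def)
  have meas: "?T \<in> lmeasurable" "?U \<in> lmeasurable"
    by (intro lmeasurable_compact compact_convex_hull; simp)+
  have "turn R P X = - turn P R X" for X
    by (simp add: turn_def algebra_simps)
  then have "?T \<inter> ?U \<subseteq> {X. turn P R X = 0}"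
    using pos by (auto simp: triangle_eq_halfplanes)
  moreover have "negligible {X. turn P R X = 0}"
    using left_turning_distinct[OF lt] by (simp add: negligible_turn_line)
  ultimately have "negligible (?T \<inter> ?U)"
    by (rule negligible_subset[rotated])
  then have "measure lebesgue (?T \<union> ?U) = measure lebesgue ?T + measure lebesgue ?U"
    using measure_Un3[OF meas] by (simp add: negligible_imp_measure0)
  then show ?thesis
    by (simp add: quad_area_def quad_region_eq[OF lt] left_of_sides_eq_triangles[OF lt]
        measure_triangle[OF pos(1)] measure_triangle[OF pos(2)])
qed

section \<open>Three vertices on a circle about the fourth\<close>

text \<open>For \<open>c = cos \<theta>\<close> and \<open>s = sin \<theta>\<close> this is the point at polar angle \<open>2 * \<theta>\<close>. Doubling the
  angle makes chords polynomial: with half-angles \<open>\<theta>\<close> and \<open>\<theta>'\<close> the chord is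
  \<open>2 * r * sin (\<theta> - \<theta>')\<close>.\<close>

definition circle_point :: "real \<Rightarrow> real \<Rightarrow> real \<Rightarrow> real^2" where
  "circle_point r c s = vector [r * (c^2 - s^2), r * (2 * s * c)]"

lemma dist_sqrt_2: "dist X Y = sqrt ((X$1 - Y$1)^2 + (X$2 - Y$2)^2)" for X Y :: "real^2"
  by (simp add: dist_vec_def L2_set_def sum_2 dist_real_def)

lemma dist_circle_point:
  assumes "r \<ge> 0" "c^2 + s^2 = 1"
  shows "dist 0 (circle_point r c s) = r"
proof -
  have "(r * (c^2 - s^2))^2 + (r * (2 * s * c))^2 = (r * (c^2 + s^2))^2"
    by (simp add: power2_eq_square algebra_simps)
  then show ?thesis
    using assms by (simp add: dist_sqrt_2 circle_point_def vector_2 real_sqrt_unique)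
qed

lemma dist_circle_points:
  assumes "r \<ge> 0" "c^2 + s^2 = 1" "c'^2 + s'^2 = 1" "s * c' - c * s' \<ge> 0"
  shows "dist (circle_point r c s) (circle_point r c' s') = 2 * r * (s * c' - c * s')"
proof -
  have "(r * (c^2 - s^2) - r * (c'^2 - s'^2))^2 + (r * (2 * s * c) - r * (2 * s' * c'))^2
      = (r * ((c^2 + s^2) - (c'^2 + s'^2)))^2 + (2 * r * (s * c' - c * s'))^2"
    by (simp add: power2_eq_square algebra_simps)
  also have "\<dots> = (2 * r * (s * c' - c * s'))^2"
    using assms(2,3) by simp
  finally show ?thesis
    using assms by (simp add: dist_sqrt_2 circle_point_def vector_2 real_sqrt_unique)
qed

text \<open>Here \<open>c, s\<close> and \<open>c', s'\<close> stand for the cosines and sines of \<open>\<alpha>\<close> and \<open>\<beta>\<close>, so that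
  \<open>s * c' - c * s'\<close> is \<open>sin (\<alpha> - \<beta>)\<close> and \<open>c * c' + s * s'\<close> is \<open>cos (\<alpha> - \<beta>)\<close>. The area is
  that of the isosceles triangles \<open>P 0 C\<close> and \<open>0 B C\<close>, with apex angles \<open>2 * (\<alpha> - \<beta>)\<close> and
  \<open>2 * \<beta>\<close> at the centre.\<close>

lemma circular_quadrilateral:
  fixes r c s c' s' :: real
  defines "P \<equiv> circle_point r c s" and "B \<equiv> circle_point r 1 0" and "C \<equiv> circle_point r c' s'"
  assumes r: "r > 0" and "c > 0" "s > 0" "c' > 0" "s' > 0"
    and cs: "c^2 + s^2 = 1" and cs': "c'^2 + s'^2 = 1"
    and diff: "s * c' - c * s' > 0"
  shows "convex_quadrilateral P 0 B C"
    and "dist P 0 = r" "dist 0 B = r" "dist 0 C = r"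
    and "dist B C = 2 * r * s'" "dist P C = 2 * r * (s * c' - c * s')" "dist P B = 2 * r * s"
    and "quad_area P 0 B C = r^2 * (s * c' - c * s') * (c * c' + s * s') + r^2 * s' * c'"
proof -
  have t1: "turn P 0 B = 2 * r^2 * s * c"
    unfolding P_def B_def circle_point_def turn_def vector_2 zero_index
    by (simp add: power2_eq_square algebra_simps)
  have t2: "turn 0 B C = 2 * r^2 * s' * c'"
    unfolding B_def C_def circle_point_def turn_def vector_2 zero_index
    by (simp add: power2_eq_square algebra_simps)
  have t3: "turn B C P = 4 * r^2 * s * s' * (s * c' - c * s')"
  proof -
    have "c^2 = 1 - s^2" "c'^2 = 1 - s'^2"
      using cs cs' by simp_all
    then have "turn B C P = (r * (- 2 * s'^2)) * (r * (2 * s * c)) - (r * (2 * s' * c')) * (r * (- 2 * s^2))"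
      by (simp add: P_def B_def C_def circle_point_def turn_def vector_2 right_diff_distrib)
    also have "\<dots> = 4 * r^2 * s * s' * (s * c' - c * s')"
      by (simp add: power2_eq_square algebra_simps)
    finally show ?thesis .
  qed
  have t4: "turn C P 0 = 2 * r^2 * (s * c' - c * s') * (c * c' + s * s')"
    unfolding P_def C_def circle_point_def turn_def vector_2 zero_index
    by (simp add: power2_eq_square algebra_simps)
  have "c * c' + s * s' > 0"
    using assms by (simp add: add_pos_pos)
  then have lt: "left_turning P 0 B C"
    unfolding left_turning_def t1 t2 t3 t4 using assms by simp
  show "convex_quadrilateral P 0 B C"
    by (rule convex_quadrilateral_left_turning[OF lt])
  show "quad_area P 0 B C = r^2 * (s * c' - c * s') * (c * c' + s * s') + r^2 * s' * c'"
    using quad_area_left_turning[OF lt] turn_four_points[of P 0 B C] t2 t4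
    by (simp add: algebra_simps)
  show "dist P 0 = r" "dist 0 B = r" "dist 0 C = r"
    using r cs cs' dist_circle_point[of r]
    by (simp_all add: P_def B_def C_def dist_commute)
  show "dist P C = 2 * r * (s * c' - c * s')"
    unfolding P_def C_def using r diff cs cs' by (intro dist_circle_points) auto
  show "dist P B = 2 * r * s"
    unfolding P_def B_def using r \<open>s > 0\<close> cs dist_circle_points[of r c s 1 0] by simp
  show "dist B C = 2 * r * s'"
    unfolding B_def C_def using r \<open>s' > 0\<close> cs' dist_circle_points[of r c' s' 1 0]
    by (simp add: dist_commute)
qed

section \<open>The rational family\<close>

theorem mainTheorem6:
  fixes p\<^sub>1 p\<^sub>2 r\<^sub>1 r\<^sub>2 :: real
  assumes "p\<^sub>1 \<in> \<rat>" and "p\<^sub>2 \<in> \<rat>" and "r\<^sub>1 \<in> \<rat>" and "r\<^sub>2 \<in> \<rat>"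
    and "p\<^sub>1 > 0" and "p\<^sub>2 > 0" and "r\<^sub>1 > 0" and "r\<^sub>2 > 0"
    and "r\<^sub>2 > r\<^sub>1"
    and "p\<^sub>2 > p\<^sub>1 * (r\<^sub>1 + r\<^sub>2) / (r\<^sub>2 - r\<^sub>1)"
  shows "\<exists>O\<^sub>0 A B C :: real^2.
    rational_quadrilateral O\<^sub>0 A B C \<and> convex_quadrilateral O\<^sub>0 A B C \<and>
    dist O\<^sub>0 A = dist A B \<and>
    dist O\<^sub>0 A = (p\<^sub>1^2 + p\<^sub>2^2) * (r\<^sub>1^2 + r\<^sub>2^2) \<and>
    dist A B = (p\<^sub>1^2 + p\<^sub>2^2) * (r\<^sub>1^2 + r\<^sub>2^2) \<and>
    dist B C = 4 * (p\<^sub>1^2 + p\<^sub>2^2) * r\<^sub>1 * r\<^sub>2 \<and>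
    dist O\<^sub>0 C = 2 * (p\<^sub>1 * r\<^sub>1 + p\<^sub>1 * r\<^sub>2 + p\<^sub>2 * r\<^sub>1 - p\<^sub>2 * r\<^sub>2)
                * (p\<^sub>1 * r\<^sub>1 - p\<^sub>1 * r\<^sub>2 - p\<^sub>2 * r\<^sub>1 - p\<^sub>2 * r\<^sub>2) \<and>
    dist O\<^sub>0 B = 2 * (r\<^sub>1^2 + r\<^sub>2^2) * (p\<^sub>2^2 - p\<^sub>1^2) \<and>
    dist A C = (p\<^sub>1^2 + p\<^sub>2^2) * (r\<^sub>1^2 + r\<^sub>2^2) \<and>
    quad_area O\<^sub>0 A B C = 2 * (p\<^sub>2^2 - p\<^sub>1^2)
                * (2 * p\<^sub>1 * r\<^sub>1 * r\<^sub>2 + p\<^sub>2 * r\<^sub>1^2 - p\<^sub>2 * r\<^sub>2^2)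
                * (p\<^sub>1 * r\<^sub>1^2 - p\<^sub>1 * r\<^sub>2^2 - 2 * p\<^sub>2 * r\<^sub>1 * r\<^sub>2)"
proof -
  define m n where "m = p\<^sub>1^2 + p\<^sub>2^2" and "n = r\<^sub>1^2 + r\<^sub>2^2"
  define k s c s' c' where "k = m * n"
    and "s = (p\<^sub>2^2 - p\<^sub>1^2) / m" and "c = 2 * p\<^sub>1 * p\<^sub>2 / m"
    and "s' = 2 * r\<^sub>1 * r\<^sub>2 / n" and "c' = (r\<^sub>2^2 - r\<^sub>1^2) / n"
  note rat = assms(1-4) and pos = assms(5-8)
  have m: "m > 0" and n: "n > 0"
    using pos by (simp_all add: m_def n_def add_pos_pos)
  have lin: "p\<^sub>1 * (r\<^sub>1 + r\<^sub>2) < p\<^sub>2 * (r\<^sub>2 - r\<^sub>1)"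
    using assms(9,10) by (simp add: pos_divide_less_eq)
  have "p\<^sub>1 * (r\<^sub>2 - r\<^sub>1) < p\<^sub>1 * (r\<^sub>1 + r\<^sub>2)"
    using pos by simp
  then have "p\<^sub>1 * (r\<^sub>2 - r\<^sub>1) < p\<^sub>2 * (r\<^sub>2 - r\<^sub>1)"
    using lin by linarith
  then have "p\<^sub>1 < p\<^sub>2"
    using assms(9) by simp
  then have sc: "s > 0" "c > 0" "s' > 0" "c' > 0" "k > 0"
    using pos m n assms(9)
    by (simp_all add: s_def c_def s'_def c'_def k_def power_strict_mono)
  have cs: "c^2 + s^2 = 1"
  proof -
    have "(2 * p\<^sub>1 * p\<^sub>2)^2 + (p\<^sub>2^2 - p\<^sub>1^2)^2 = m^2"
      unfolding m_def by algebra
    then show ?thesis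
      using m by (simp add: c_def s_def power_divide add_divide_distrib[symmetric])
  qed
  have cs': "c'^2 + s'^2 = 1"
  proof -
    have "(r\<^sub>2^2 - r\<^sub>1^2)^2 + (2 * r\<^sub>1 * r\<^sub>2)^2 = n^2"
      unfolding n_def by algebra
    then show ?thesis
      using n by (simp add: c'_def s'_def power_divide add_divide_distrib[symmetric])
  qed
  \<comment> \<open>With \<open>u = p\<^sub>1 * r\<^sub>1 - p\<^sub>2 * r\<^sub>2\<close> and \<open>v = p\<^sub>1 * r\<^sub>2 + p\<^sub>2 * r\<^sub>1\<close> this is \<open>2 * (u^2 - v^2)\<close>; both of
    its linear factors will turn out negative.\<close>
  let ?d = "2 * (p\<^sub>1 * r\<^sub>1 + p\<^sub>1 * r\<^sub>2 + p\<^sub>2 * r\<^sub>1 - p\<^sub>2 * r\<^sub>2)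
                * (p\<^sub>1 * r\<^sub>1 - p\<^sub>1 * r\<^sub>2 - p\<^sub>2 * r\<^sub>1 - p\<^sub>2 * r\<^sub>2)"
  let ?K = "2 * (p\<^sub>2^2 - p\<^sub>1^2)
                * (2 * p\<^sub>1 * r\<^sub>1 * r\<^sub>2 + p\<^sub>2 * r\<^sub>1^2 - p\<^sub>2 * r\<^sub>2^2)
                * (p\<^sub>1 * r\<^sub>1^2 - p\<^sub>1 * r\<^sub>2^2 - 2 * p\<^sub>2 * r\<^sub>1 * r\<^sub>2)"
  have ms: "m * s = p\<^sub>2^2 - p\<^sub>1^2" "m * c = 2 * p\<^sub>1 * p\<^sub>2"
    "n * s' = 2 * r\<^sub>1 * r\<^sub>2" "n * c' = r\<^sub>2^2 - r\<^sub>1^2"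
    using m n by (simp_all add: s_def c_def s'_def c'_def)
  have d: "2 * k * (s * c' - c * s') = ?d"
  proof -
    have "2 * k * (s * c' - c * s') = 2 * ((m * s) * (n * c') - (m * c) * (n * s'))"
      by (simp add: k_def algebra_simps)
    also have "\<dots> = ?d"
      unfolding ms by algebra
    finally show ?thesis .
  qed
  have "?d > 0"
  proof (intro mult_neg_neg)
    show "2 * (p\<^sub>1 * r\<^sub>1 + p\<^sub>1 * r\<^sub>2 + p\<^sub>2 * r\<^sub>1 - p\<^sub>2 * r\<^sub>2) < 0"
      using lin by (simp add: algebra_simps)
    have "p\<^sub>1 * r\<^sub>1 < p\<^sub>1 * r\<^sub>2" "0 < p\<^sub>2 * r\<^sub>1" "0 < p\<^sub>2 * r\<^sub>2"
      using pos assms(9) by simp_all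
    then show "p\<^sub>1 * r\<^sub>1 - p\<^sub>1 * r\<^sub>2 - p\<^sub>2 * r\<^sub>1 - p\<^sub>2 * r\<^sub>2 < 0"
      by linarith
  qed
  then have diff: "s * c' - c * s' > 0"
    using d sc(5) by (metis zero_less_mult_pos mult_pos_pos zero_less_numeral)
  have K: "k^2 * (s * c' - c * s') * (c * c' + s * s') + k^2 * s' * c' = ?K"
  proof -
    \<comment> \<open>The factor \<open>c^2 + s^2\<close> makes the sum homogeneous of degree 2 in \<open>c\<close> and \<open>s\<close>, so that
      \<open>k^2\<close> clears all denominators; \<open>s\<close> then factors out, as in
      \<open>sin (2 * (\<alpha> - \<beta>)) + sin (2 * \<beta>) = 2 * sin \<alpha> * cos (\<alpha> - 2 * \<beta>)\<close>.\<close>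
    have "k^2 * (s * c' - c * s') * (c * c' + s * s') + k^2 * s' * c'
        = k^2 * (s * c' - c * s') * (c * c' + s * s') + k^2 * s' * c' * (c^2 + s^2)"
      using cs by simp
    also have "\<dots> = m * s * (m * c * ((n * c')^2 - (n * s')^2) + 2 * (m * s) * (n * s') * (n * c'))"
      unfolding k_def by algebra
    also have "\<dots> = ?K"
      unfolding ms by algebra
    finally show ?thesis .
  qed
  define P B C where "P = circle_point k c s" and "B = circle_point k 1 0"
    and "C = circle_point k c' s'"
  note Q = circular_quadrilateral[OF sc(5,2,1,4,3) cs cs' diff, folded P_def B_def C_def]
  have dists: "dist P 0 = (p\<^sub>1^2 + p\<^sub>2^2) * (r\<^sub>1^2 + r\<^sub>2^2)"
    "dist 0 B = (p\<^sub>1^2 + p\<^sub>2^2) * (r\<^sub>1^2 + r\<^sub>2^2)"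
    "dist 0 C = (p\<^sub>1^2 + p\<^sub>2^2) * (r\<^sub>1^2 + r\<^sub>2^2)"
    using Q by (simp_all add: k_def m_def n_def)
  have BC: "dist B C = 4 * (p\<^sub>1^2 + p\<^sub>2^2) * r\<^sub>1 * r\<^sub>2"
    using Q(5) ms(3) by (simp add: k_def m_def[symmetric] mult.assoc)
  have PB: "dist P B = 2 * (r\<^sub>1^2 + r\<^sub>2^2) * (p\<^sub>2^2 - p\<^sub>1^2)"
    unfolding Q(7) k_def ms(1)[symmetric] n_def by simp
  have PC: "dist P C = ?d"
    using Q(6) d by simp
  have area: "quad_area P 0 B C = ?K"
    using Q(8) K by simp
  have "rational_quadrilateral P 0 B C"
    unfolding rational_quadrilateral_def dist_commute[of C P] dists BC PB PC area
    using Q(1) rat by (simp add: convex_quadrilateral_def)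
  then show ?thesis
    using Q(1) dists BC PB PC area by (intro exI[of _ P] exI[of _ 0] exI[of _ B] exI[of _ C]) simp
qed

end
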